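(* Let $\star$ be a t-definer, let $n\ge 1$, and let $\{(M_i,d_i)\}_{i=1}^n$ be a family of $\star$-metric spaces. Let $M=\prod_{1\le i\le n}M_i$ and for $\bar{x}=(x_1,\dots,x_n),\ \bar{y}=(y_1,\dots,y_n)\in M$ define $$d_{max}(\bar{x},\bar{y})=\max_{1\le i\le n}d_i(x_i,y_i),\qquad d_T(\bar{x},\bar{y})=d_1(x_1,y_1)\star d_2(x_2,y_2)\star\cdots\star d_n(x_n,y_n).$$ Then $d_{max}$ and $d_T$ are $\star$-metrics on $M$. Furthermore, the topologies $\tau_{d_{max}}$ and $\tau_{d_T}$ induced on $M$ by these two $\star$-metrics are both equal to the product topology on $M$ (where each $M_i$ carries the topology $\tau_{d_i}$).
   Context: A t-definer is a function $\star:[0,\infty)^2\to[0,\infty)$ such that for all $a,b,c\ge 0$: $a\star b=b\star a$; $a\star(b\star c)=(a\star b)\star c$; $a\le b$ implies $a\star c\le b\star c$ and $c\star a\le c\star b$; $a\star 0=a$; and $\star$ is continuous in its first component with respect to the Euclidean topology. For a t-definer $\star$ and a nonempty set $M$, a $\star$-metric on $M$ is a function $d:M^2\to[0,\infty)$ such that for all $x,y,z\in M$: $d(x,y)=0$ if and only if $x=y$; $d(x,y)=d(y,x)$; and $d(x,y)\le d(x,z)\star d(z,y)$. Then $(M,d)$ is called a $\star$-metric space. For $a\in M$ and $r>0$, the open ball is $N_r(a)=\{b\in M: d(a,b)<r\}$. A subset $A\subseteq M$ is open if for every $x\in A$ there is $\epsilon>0$ with $N_\epsilon(x)\subseteq A$.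 The collection of all open subsets of $M$ is a topology on $M$, denoted $\tau_d$ and called the topology induced by $d$ (the $\star$-metric topology). *)

theory Defs
  imports "HOL-Analysis.Analysis"
begin

(* The half-line [0,\<infinity>) is encoded by guards: the values of star outside
   [0,\<infinity>) x [0,\<infinity>), and of d outside M x M, are irrelevant. *)

definition t_definer :: "(real \<Rightarrow> real \<Rightarrow> real) \<Rightarrow> bool" where
  "t_definer star \<longleftrightarrow>
     (\<forall>a\<ge>0. \<forall>b\<ge>0. star a b \<ge> 0) \<and>
     (\<forall>a\<ge>0. \<forall>b\<ge>0. star a b = star b a) \<and>
     (\<forall>a\<ge>0. \<forall>b\<ge>0. \<forall>c\<ge>0. star a (star b c) = star (star a b) c) \<and>
     (\<forall>a\<ge>0. \<forall>b\<ge>0. \<forall>c\<ge>0. a \<le> b \<longrightarrow> star a c \<le> star b c \<and> star c a \<le> star c b) \<and>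
     (\<forall>a\<ge>0. star a 0 = a) \<and>
     (\<forall>b\<ge>0. continuous_on {0..} (\<lambda>a. star a b))"

definition star_metric :: "(real \<Rightarrow> real \<Rightarrow> real) \<Rightarrow> 'a set \<Rightarrow> ('a \<Rightarrow> 'a \<Rightarrow> real) \<Rightarrow> bool" where
  "star_metric star M d \<longleftrightarrow>
     M \<noteq> {} \<and>
     (\<forall>x\<in>M. \<forall>y\<in>M. d x y \<ge> 0) \<and>
     (\<forall>x\<in>M. \<forall>y\<in>M. d x y = 0 \<longleftrightarrow> x = y) \<and>
     (\<forall>x\<in>M. \<forall>y\<in>M. d x y = d y x) \<and>
     (\<forall>x\<in>M. \<forall>y\<in>M. \<forall>z\<in>M. d x y \<le> star (d x z) (d z y))"

definition star_ball :: "'a set \<Rightarrow> ('a \<Rightarrow> 'a \<Rightarrow> real) \<Rightarrow> 'a \<Rightarrow> real \<Rightarrow> 'a set" where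
  "star_ball M d a r = {b \<in> M. d a b < r}"

definition star_open :: "'a set \<Rightarrow> ('a \<Rightarrow> 'a \<Rightarrow> real) \<Rightarrow> 'a set \<Rightarrow> bool" where
  "star_open M d A \<longleftrightarrow> A \<subseteq> M \<and> (\<forall>x\<in>A. \<exists>\<epsilon>>0. star_ball M d x \<epsilon> \<subseteq> A)"

definition star_topology :: "'a set \<Rightarrow> ('a \<Rightarrow> 'a \<Rightarrow> real) \<Rightarrow> 'a topology" where
  "star_topology M d = topology (star_open M d)"

lemma istopology_star_open: "istopology (star_open M d)"
  unfolding istopology_def
proof (intro conjI allI impI)
  fix S T assume S: "star_open M d S" and T: "star_open M d T"
  show "star_open M d (S \<inter> T)"
    unfolding star_open_def
  proof (intro conjI ballI)
    show "S \<inter> T \<subseteq> M" using S by (auto simp: star_open_def)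
    fix x assume "x \<in> S \<inter> T"
    then obtain e f where "e > 0" "star_ball M d x e \<subseteq> S" "f > 0" "star_ball M d x f \<subseteq> T"
      using S T unfolding star_open_def by blast
    then have "min e f > 0" "star_ball M d x (min e f) \<subseteq> S \<inter> T"
      by (auto simp: star_ball_def)
    then show "\<exists>\<epsilon>>0. star_ball M d x \<epsilon> \<subseteq> S \<inter> T" by blast
  qed
next
  fix \<K> assume "\<forall>K\<in>\<K>. star_open M d K"
  then show "star_open M d (\<Union>\<K>)"
    unfolding star_open_def by (meson Union_iff Union_least Union_upper subset_trans)
qed

lemma openin_star_topology: "openin (star_topology M d) = star_open M d"
  by (simp add: star_topology_def istopology_star_open)

lemma topspace_star_topology: "topspace (star_topology M d) = M"
proof
  have "star_open M d M"
    by (auto simp: star_open_def star_ball_def intro: exI[of _ "1::real"])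
  then show "M \<subseteq> topspace (star_topology M d)"
    by (simp add: openin_star_topology openin_subset)
  show "topspace (star_topology M d) \<subseteq> M"
    by (metis openin_star_topology openin_topspace star_open_def)
qed

(* A point of the product is a function on {1..n} that is undefined elsewhere. *)
definition prod_carrier :: "nat \<Rightarrow> (nat \<Rightarrow> 'a set) \<Rightarrow> (nat \<Rightarrow> 'a) set" where
  "prod_carrier n M = (\<Pi>\<^sub>E i\<in>{1..n}. M i)"

definition d_max :: "nat \<Rightarrow> (nat \<Rightarrow> 'a \<Rightarrow> 'a \<Rightarrow> real) \<Rightarrow> (nat \<Rightarrow> 'a) \<Rightarrow> (nat \<Rightarrow> 'a) \<Rightarrow> real" where
  "d_max n d x y = Max ((\<lambda>i. d i (x i) (y i)) ` {1..n})"

(* Bracketed to the left; for n = 1 this is d 1 (x 1) (y 1). *)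
definition d_T :: "(real \<Rightarrow> real \<Rightarrow> real) \<Rightarrow> nat \<Rightarrow> (nat \<Rightarrow> 'a \<Rightarrow> 'a \<Rightarrow> real)
    \<Rightarrow> (nat \<Rightarrow> 'a) \<Rightarrow> (nat \<Rightarrow> 'a) \<Rightarrow> real" where
  "d_T star n d x y =
     foldl star (d 1 (x 1) (y 1)) (map (\<lambda>i. d i (x i) (y i)) [2..<Suc n])"

end

theory Submission
  imports Defs
begin

text \<open>
  Continuity of \<open>\<lambda>t. t \<star> c\<close> at \<open>0\<close>, where its value is \<open>c\<close>, is used twice: with \<open>c = d x y\<close> it makes
  balls open, and with \<open>c = \<epsilon>/2\<close> it shows that a \<open>\<star>\<close>-sum of finitely many small numbers is small.
  Since moreover every summand is at most the \<open>\<star>\<close>-sum, \<open>d_max\<close> and \<open>d_T\<close> are uniformly equivalent;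
  and \<open>d_max\<close>-balls are products of balls.
\<close>

section \<open>The iterated sum behind \<open>d_T\<close>\<close>

definition star_sum :: "(real \<Rightarrow> real \<Rightarrow> real) \<Rightarrow> (nat \<Rightarrow> real) \<Rightarrow> nat \<Rightarrow> real" where
  "star_sum star f n = foldl star (f 1) (map f [2..<Suc n])"

lemma star_sum_1: "star_sum star f (Suc 0) = f (Suc 0)"
  by (simp add: star_sum_def)

lemma star_sum_Suc: "1 \<le> n \<Longrightarrow> star_sum star f (Suc n) = star (star_sum star f n) (f (Suc n))"
  by (simp add: star_sum_def)

text \<open>Detaches the summands from points and metrics, so that they can be an arbitrary function
  in the inductions on \<open>n\<close>.\<close>

lemma d_T_eq_star_sum: "d_T star n d x y = star_sum star (\<lambda>i. d i (x i) (y i)) n"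
  by (simp add: d_T_def star_sum_def)

section \<open>Arithmetic of a t-definer\<close>

context
  fixes star :: "real \<Rightarrow> real \<Rightarrow> real"
  assumes star: "t_definer star"
begin

lemma star_nonneg: "0 \<le> a \<Longrightarrow> 0 \<le> b \<Longrightarrow> 0 \<le> star a b"
  using star by (simp add: t_definer_def)

lemma star_commute: "0 \<le> a \<Longrightarrow> 0 \<le> b \<Longrightarrow> star a b = star b a"
  using star unfolding t_definer_def by metis

lemma star_assoc: "0 \<le> a \<Longrightarrow> 0 \<le> b \<Longrightarrow> 0 \<le> c \<Longrightarrow> star a (star b c) = star (star a b) c"
  using star unfolding t_definer_def by metis

lemma star_mono:
  assumes "0 \<le> a" "a \<le> a'" "0 \<le> b" "b \<le> b'"
  shows "star a b \<le> star a' b'"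
proof -
  have "star a b \<le> star a' b" "star a' b \<le> star a' b'"
    using star assms by (simp_all add: t_definer_def)
  then show ?thesis by simp
qed

lemma star_0_right: "0 \<le> a \<Longrightarrow> star a 0 = a"
  using star unfolding t_definer_def by metis

lemma star_ge_left: "0 \<le> a \<Longrightarrow> 0 \<le> b \<Longrightarrow> a \<le> star a b"
  using star_mono[of a a 0 b] by (simp add: star_0_right)

lemma star_ge_right: "0 \<le> a \<Longrightarrow> 0 \<le> b \<Longrightarrow> b \<le> star a b"
  using star_ge_left[of b a] by (simp add: star_commute)

text \<open>Reassociating exposes the inner factor \<open>star b c\<close>, which commutativity then
  swaps. This is the inductive step of \<open>star_sum_star\<close>.\<close>

lemma star_interchange:
  assumes "0 \<le> a" "0 \<le> b" "0 \<le> c" "0 \<le> e"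
  shows "star (star a b) (star c e) = star (star a c) (star b e)"
proof -
  have "star (star a b) (star c e) = star a (star (star b c) e)"
    using assms by (simp add: star_assoc star_nonneg)
  also have "star b c = star c b"
    using assms by (simp add: star_commute)
  also have "star a (star (star c b) e) = star (star a c) (star b e)"
    using assms by (simp add: star_assoc star_nonneg)
  finally show ?thesis .
qed

lemma star_small:
  assumes "0 \<le> c" "c < r"
  obtains \<delta> where "0 < \<delta>" "\<And>t. 0 \<le> t \<Longrightarrow> t < \<delta> \<Longrightarrow> star t c < r"
proof -
  have "continuous_on {0..} (\<lambda>t. star t c)"
    using star assms by (simp add: t_definer_def)
  \<comment> \<open>The limit value at \<open>0\<close> is \<open>c\<close>, so the positive gap
    \<open>r - c\<close> is the tolerance.\<close>
  then obtain \<delta> where "0 < \<delta>"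
    and \<delta>: "\<And>t. t \<in> {0..} \<Longrightarrow> dist t 0 < \<delta> \<Longrightarrow> dist (star t c) (star 0 c) < r - c"
    using assms unfolding continuous_on_iff
    by (metis atLeast_iff diff_gt_0_iff_gt order_refl)
  have "star 0 c = c"
    using assms star_commute[of 0 c] by (simp add: star_0_right)
  then have "star t c < r" if "0 \<le> t" "t < \<delta>" for t
    using \<delta>[of t] that by (simp add: dist_real_def)
  with \<open>0 < \<delta>\<close> show thesis by (rule that)
qed

section \<open>Finite \<open>star\<close>-sums of nonnegative numbers\<close>

lemma star_sum_nonneg:
  assumes "1 \<le> n" "\<And>i. i \<in> {1..n} \<Longrightarrow> 0 \<le> f i"
  shows "0 \<le> star_sum star f n"
  using assms by (induction n rule: nat_induct_at_least) (auto simp: star_sum_1 star_sum_Suc star_nonneg)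

text \<open>Both arguments of \<open>star\<close> lie below its value: the last summand is the right
  argument, and every earlier one lies below the left argument by induction.\<close>

lemma le_star_sum:
  assumes "1 \<le> n" "\<And>i. i \<in> {1..n} \<Longrightarrow> 0 \<le> f i" "i \<in> {1..n}"
  shows "f i \<le> star_sum star f n"
  using assms
proof (induction n rule: nat_induct_at_least)
  case base
  then show ?case by (simp add: star_sum_1)
next
  case (Suc n)
  have nonneg: "0 \<le> star_sum star f n" "0 \<le> f (Suc n)"
    using Suc.hyps Suc.prems by (auto intro: star_sum_nonneg)
  show ?case
  proof (cases "i = Suc n")
    case True
    then show ?thesis
      using Suc.hyps nonneg by (simp add: star_sum_Suc star_ge_right)
  next
    case False
    then have "f i \<le> star_sum star f n"
      using Suc by auto
    also have "\<dots> \<le> star_sum star f (Suc n)"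
      using Suc.hyps nonneg by (simp add: star_sum_Suc star_ge_left)
    finally show ?thesis .
  qed
qed

lemma star_sum_0:
  assumes "1 \<le> n" "\<And>i. i \<in> {1..n} \<Longrightarrow> f i = 0"
  shows "star_sum star f n = 0"
  using assms by (induction n rule: nat_induct_at_least) (auto simp: star_sum_1 star_sum_Suc star_0_right)

lemma star_sum_mono:
  assumes "1 \<le> n" "\<And>i. i \<in> {1..n} \<Longrightarrow> 0 \<le> f i" "\<And>i. i \<in> {1..n} \<Longrightarrow> f i \<le> g i"
  shows "star_sum star f n \<le> star_sum star g n"
  using assms
  by (induction n rule: nat_induct_at_least)
    (auto simp: star_sum_1 star_sum_Suc intro!: star_mono star_sum_nonneg)

text \<open>Regroups the coordinatewise triangle inequalities into the one for
  \<open>d_T\<close>.\<close>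

lemma star_sum_star:
  assumes "1 \<le> n" "\<And>i. i \<in> {1..n} \<Longrightarrow> 0 \<le> f i" "\<And>i. i \<in> {1..n} \<Longrightarrow> 0 \<le> g i"
  shows "star_sum star (\<lambda>i. star (f i) (g i)) n = star (star_sum star f n) (star_sum star g n)"
  using assms
  by (induction n rule: nat_induct_at_least)
    (auto simp: star_sum_1 star_sum_Suc intro!: star_interchange star_sum_nonneg)

text \<open>Halving alone fails, since \<open>star (\<epsilon> / 2) (\<epsilon> / 2)\<close> may
  exceed \<open>\<epsilon>\<close>. Instead the last summand stays below
  \<open>\<epsilon> / 2\<close> and continuity dictates a bound \<open>\<eta>\<close> for the sum of
  the others; hence the induction needs \<open>\<epsilon>\<close> arbitrary.\<close>

lemma star_sum_small:
  assumes "1 \<le> n" "0 < \<epsilon>"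
  shows "\<exists>\<delta>>0. \<forall>f. (\<forall>i\<in>{1..n}. 0 \<le> f i \<and> f i < \<delta>) \<longrightarrow> star_sum star f n < \<epsilon>"
  using assms
proof (induction n arbitrary: \<epsilon> rule: nat_induct_at_least)
  case base
  then show ?case by (auto simp: star_sum_1)
next
  case (Suc n)
  obtain \<eta> where \<eta>: "0 < \<eta>" "\<And>t. 0 \<le> t \<Longrightarrow> t < \<eta> \<Longrightarrow> star t (\<epsilon> / 2) < \<epsilon>"
    using star_small[of "\<epsilon> / 2" \<epsilon>] Suc.prems by auto
  obtain \<delta> where \<delta>: "0 < \<delta>"
    "\<And>f. (\<forall>i\<in>{1..n}. 0 \<le> f i \<and> f i < \<delta>) \<Longrightarrow> star_sum star f n < \<eta>"
    using Suc.IH[OF \<eta>(1)] by blast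
  have "star_sum star f (Suc n) < \<epsilon>"
    if f: "\<forall>i\<in>{1..Suc n}. 0 \<le> f i \<and> f i < min \<delta> (\<epsilon> / 2)" for f
  proof -
    have nonneg: "0 \<le> star_sum star f n"
      using Suc.hyps f by (intro star_sum_nonneg) auto
    have "star_sum star f (Suc n) \<le> star (star_sum star f n) (\<epsilon> / 2)"
      using Suc.hyps f nonneg by (auto simp: star_sum_Suc less_imp_le intro!: star_mono)
    also have "\<dots> < \<epsilon>"
      using f nonneg by (intro \<eta> \<delta>) auto
    finally show ?thesis .
  qed
  then show ?case
    using \<delta>(1) Suc.prems by (intro exI[of _ "min \<delta> (\<epsilon> / 2)"]) auto
qed

section \<open>Open balls\<close>

lemma openin_star_ball:
  assumes "star_metric star M d" "a \<in> M"
  shows "openin (star_topology M d) (star_ball M d a r)"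
  unfolding openin_star_topology star_open_def
proof (intro conjI ballI)
  show "star_ball M d a r \<subseteq> M"
    by (auto simp: star_ball_def)
  fix b assume "b \<in> star_ball M d a r"
  then have b: "b \<in> M" "d a b < r" by (auto simp: star_ball_def)
  have nonneg: "0 \<le> d x y" if "x \<in> M" "y \<in> M" for x y
    using assms that by (simp add: star_metric_def)
  \<comment> \<open>For ordinary addition the radius would be \<open>r - d a b\<close>; for general
    \<open>star\<close>, continuity supplies one.\<close>
  obtain \<delta> where \<delta>: "0 < \<delta>" "\<And>t. 0 \<le> t \<Longrightarrow> t < \<delta> \<Longrightarrow> star t (d a b) < r"
    using star_small[OF nonneg b(2)] assms b by blast
  have "d a c < r" if c: "c \<in> M" "d b c < \<delta>" for c
  proof -
    have "d a c \<le> star (d a b) (d b c)"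
      using assms b c by (simp add: star_metric_def)
    \<comment> \<open>The small distance must be the first argument, the one that varies in
      \<open>star_small\<close>.\<close>
    also have "\<dots> = star (d b c) (d a b)"
      using assms b c by (simp add: star_commute nonneg)
    also have "\<dots> < r"
      using b c by (simp add: \<delta> nonneg)
    finally show ?thesis .
  qed
  then show "\<exists>\<epsilon>>0. star_ball M d b \<epsilon> \<subseteq> star_ball M d a r"
    using \<delta>(1) by (auto simp: star_ball_def)
qed

end

section \<open>Comparison of the topologies of two distance functions\<close>

lemma star_open_coarser:
  assumes "star_open M d A"
    and "\<And>\<epsilon>. 0 < \<epsilon> \<Longrightarrow> \<exists>\<delta>>0. \<forall>x\<in>M. \<forall>y\<in>M. d' x y < \<delta> \<longrightarrow> d x y < \<epsilon>"
  shows "star_open M d' A"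
  unfolding star_open_def
proof (intro conjI ballI)
  show "A \<subseteq> M" using assms(1) by (simp add: star_open_def)
  fix x assume "x \<in> A"
  then obtain \<epsilon> where "0 < \<epsilon>" "star_ball M d x \<epsilon> \<subseteq> A"
    using assms(1) by (auto simp: star_open_def)
  moreover obtain \<delta> where "0 < \<delta>" "\<forall>x\<in>M. \<forall>y\<in>M. d' x y < \<delta> \<longrightarrow> d x y < \<epsilon>"
    using assms(2)[OF \<open>0 < \<epsilon>\<close>] by blast
  \<comment> \<open>The \<open>\<delta>\<close>-ball of \<open>d'\<close> about \<open>x\<close>
    lies in the \<open>\<epsilon>\<close>-ball of \<open>d\<close>.\<close>
  ultimately show "\<exists>\<delta>>0. star_ball M d' x \<delta> \<subseteq> A"
    using \<open>x \<in> A\<close> \<open>A \<subseteq> M\<close> by (intro exI[of _ \<delta>]) (auto simp: star_ball_def)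
qed

lemma star_topology_eqI:
  assumes "\<And>\<epsilon>. 0 < \<epsilon> \<Longrightarrow> \<exists>\<delta>>0. \<forall>x\<in>M. \<forall>y\<in>M. d' x y < \<delta> \<longrightarrow> d x y < \<epsilon>"
    and "\<And>\<epsilon>. 0 < \<epsilon> \<Longrightarrow> \<exists>\<delta>>0. \<forall>x\<in>M. \<forall>y\<in>M. d x y < \<delta> \<longrightarrow> d' x y < \<epsilon>"
  shows "star_topology M d = star_topology M d'"
proof -
  have "star_open M d = star_open M d'"
    using star_open_coarser[of M d _ d'] star_open_coarser[of M d' _ d] assms by blast
  then show ?thesis by (simp add: star_topology_def)
qed

section \<open>Maxima over coordinates and equality of points\<close>

lemma d_max_less_iff: "1 \<le> n \<Longrightarrow> d_max n d x y < r \<longleftrightarrow> (\<forall>i\<in>{1..n}. d i (x i) (y i) < r)"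
  by (auto simp: d_max_def)

lemma d_max_le_iff: "1 \<le> n \<Longrightarrow> d_max n d x y \<le> r \<longleftrightarrow> (\<forall>i\<in>{1..n}. d i (x i) (y i) \<le> r)"
  by (auto simp: d_max_def)

lemma le_d_max: "i \<in> {1..n} \<Longrightarrow> d i (x i) (y i) \<le> d_max n d x y"
  by (auto simp: d_max_def)

text \<open>Off \<open>{1..n}\<close> both functions are \<open>undefined\<close>, so only the
  coordinates matter.\<close>

lemma prod_carrier_eq_iff:
  assumes "x \<in> prod_carrier n M" "y \<in> prod_carrier n M"
  shows "x = y \<longleftrightarrow> (\<forall>i\<in>{1..n}. x i = y i)"
  using assms PiE_ext unfolding prod_carrier_def by metis

section \<open>The two metrics on the product\<close>

context
  fixes star :: "real \<Rightarrow> real \<Rightarrow> real"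
    and n :: nat
    and M :: "nat \<Rightarrow> 'a set"
    and d :: "nat \<Rightarrow> 'a \<Rightarrow> 'a \<Rightarrow> real"
  assumes star: "t_definer star"
    and n: "1 \<le> n"
    and metric: "\<And>i. i \<in> {1..n} \<Longrightarrow> star_metric star (M i) (d i)"
begin

lemma prod_carrier_nonempty: "prod_carrier n M \<noteq> {}"
  using metric by (auto simp: prod_carrier_def PiE_eq_empty_iff star_metric_def)

lemma component_metric:
  assumes "i \<in> {1..n}" "x \<in> prod_carrier n M" "y \<in> prod_carrier n M"
  shows "0 \<le> d i (x i) (y i)"
    and "d i (x i) (y i) = 0 \<longleftrightarrow> x i = y i"
    and "d i (x i) (y i) = d i (y i) (x i)"
    and "z \<in> prod_carrier n M \<Longrightarrow> d i (x i) (y i) \<le> star (d i (x i) (z i)) (d i (z i) (y i))"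
proof -
  have mem: "w i \<in> M i" if "w \<in> prod_carrier n M" for w
    using that assms(1) unfolding prod_carrier_def by (rule PiE_mem)
  note * = metric[OF assms(1)] mem[OF assms(2)] mem[OF assms(3)]
  show "0 \<le> d i (x i) (y i)"
    using * by (simp add: star_metric_def)
  show "d i (x i) (y i) = 0 \<longleftrightarrow> x i = y i"
    using * by (simp add: star_metric_def)
  show "d i (x i) (y i) = d i (y i) (x i)"
    using * by (simp add: star_metric_def)
  show "d i (x i) (y i) \<le> star (d i (x i) (z i)) (d i (z i) (y i))" if "z \<in> prod_carrier n M"
    using * mem[OF that] unfolding star_metric_def by blast
qed

lemma d_max_nonneg:
  assumes "x \<in> prod_carrier n M" "y \<in> prod_carrier n M"
  shows "0 \<le> d_max n d x y"
proof -
  have "1 \<in> {1..n}" using n by simp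
  with component_metric(1)[OF this assms] le_d_max[OF this, of d x y] show ?thesis by linarith
qed

lemma star_metric_d_max: "star_metric star (prod_carrier n M) (d_max n d)"
  unfolding star_metric_def
proof (intro conjI ballI)
  show "prod_carrier n M \<noteq> {}" by (rule prod_carrier_nonempty)
  fix x y assume xy: "x \<in> prod_carrier n M" "y \<in> prod_carrier n M"
  show "0 \<le> d_max n d x y" using xy by (rule d_max_nonneg)
  \<comment> \<open>Nonnegativity replaces the equation by an inequality, which
    \<open>d_max_le_iff\<close> splits over the coordinates.\<close>
  have "d_max n d x y = 0 \<longleftrightarrow> d_max n d x y \<le> 0"
    using d_max_nonneg[OF xy] by linarith
  also have "\<dots> \<longleftrightarrow> (\<forall>i\<in>{1..n}. d i (x i) (y i) = 0)"
    unfolding d_max_le_iff[OF n] using component_metric(1)[OF _ xy] by (force intro: order_antisym)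
  also have "\<dots> \<longleftrightarrow> x = y"
    using component_metric(2)[OF _ xy] prod_carrier_eq_iff[OF xy] by simp
  finally show "d_max n d x y = 0 \<longleftrightarrow> x = y" .
  have "(\<lambda>i. d i (x i) (y i)) ` {1..n} = (\<lambda>i. d i (y i) (x i)) ` {1..n}"
    using component_metric(3)[OF _ xy] by (intro image_cong) auto
  then show "d_max n d x y = d_max n d y x"
    by (simp add: d_max_def)
  fix z assume z: "z \<in> prod_carrier n M"
  \<comment> \<open>Monotonicity enlarges both coordinate distances to maxima; the resulting bound
    no longer depends on \<open>i\<close>.\<close>
  have "d i (x i) (y i) \<le> star (d_max n d x z) (d_max n d z y)" if i: "i \<in> {1..n}" for i
    using component_metric(4)[OF i xy z] component_metric(1)[OF i] xy z
      star_mono[OF star, OF _ le_d_max[OF i, of d x z] _ le_d_max[OF i, of d z y]]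
    by (meson order_trans)
  then show "d_max n d x y \<le> star (d_max n d x z) (d_max n d z y)"
    by (simp add: d_max_le_iff[OF n])
qed

lemma star_metric_d_T: "star_metric star (prod_carrier n M) (d_T star n d)"
  unfolding star_metric_def
proof (intro conjI ballI)
  show "prod_carrier n M \<noteq> {}" by (rule prod_carrier_nonempty)
  fix x y assume xy: "x \<in> prod_carrier n M" "y \<in> prod_carrier n M"
  note nonneg = component_metric(1)
  show "0 \<le> d_T star n d x y"
    unfolding d_T_eq_star_sum using nonneg[OF _ xy] by (intro star_sum_nonneg[OF star n])
  have "d_T star n d x y = 0 \<longleftrightarrow> (\<forall>i\<in>{1..n}. d i (x i) (y i) = 0)"
  proof
    \<comment> \<open>Each summand is squeezed between \<open>0\<close> and the vanishing
      sum.\<close>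
    assume "d_T star n d x y = 0"
    then show "\<forall>i\<in>{1..n}. d i (x i) (y i) = 0"
      using le_star_sum[OF star n, of "\<lambda>i. d i (x i) (y i)"] nonneg[OF _ xy]
      unfolding d_T_eq_star_sum by (metis order_antisym)
  next
    assume "\<forall>i\<in>{1..n}. d i (x i) (y i) = 0"
    then show "d_T star n d x y = 0"
      unfolding d_T_eq_star_sum by (intro star_sum_0[OF star n]) auto
  qed
  also have "\<dots> \<longleftrightarrow> x = y"
    using component_metric(2)[OF _ xy] prod_carrier_eq_iff[OF xy] by simp
  finally show "d_T star n d x y = 0 \<longleftrightarrow> x = y" .
  \<comment> \<open>The summand functions are known to agree only on \<open>{1..n}\<close>, so
    monotonicity is applied in both directions.\<close>
  show "d_T star n d x y = d_T star n d y x"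
    unfolding d_T_eq_star_sum
    using component_metric(3)[OF _ xy] nonneg[OF _ xy] nonneg[OF _ xy(2,1)]
    by (intro order_antisym star_sum_mono[OF star n]) simp_all
  fix z assume z: "z \<in> prod_carrier n M"
  have "d_T star n d x y \<le> star_sum star (\<lambda>i. star (d i (x i) (z i)) (d i (z i) (y i))) n"
    unfolding d_T_eq_star_sum
    using xy z by (intro star_sum_mono[OF star n] nonneg component_metric(4))
  also have "\<dots> = star (d_T star n d x z) (d_T star n d z y)"
    unfolding d_T_eq_star_sum using xy z by (intro star_sum_star[OF star n] nonneg)
  finally show "d_T star n d x y \<le> star (d_T star n d x z) (d_T star n d z y)" .
qed

section \<open>The induced topologies\<close>

lemma star_topology_d_T_eq_d_max:
  "star_topology (prod_carrier n M) (d_T star n d) = star_topology (prod_carrier n M) (d_max n d)"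
proof (rule star_topology_eqI)
  fix \<epsilon> :: real assume "0 < \<epsilon>"
  obtain \<delta> where \<delta>: "0 < \<delta>"
    "\<And>f. (\<forall>i\<in>{1..n}. 0 \<le> f i \<and> f i < \<delta>) \<Longrightarrow> star_sum star f n < \<epsilon>"
    using star_sum_small[OF star n \<open>0 < \<epsilon>\<close>] by blast
  have "d_T star n d x y < \<epsilon>"
    if xy: "x \<in> prod_carrier n M" "y \<in> prod_carrier n M" and "d_max n d x y < \<delta>" for x y
    unfolding d_T_eq_star_sum
    using component_metric(1)[OF _ xy] that(3) by (intro \<delta>(2)) (simp add: d_max_less_iff[OF n])
  with \<delta>(1) show "\<exists>\<delta>>0. \<forall>x\<in>prod_carrier n M. \<forall>y\<in>prod_carrier n M.
      d_max n d x y < \<delta> \<longrightarrow> d_T star n d x y < \<epsilon>"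
    by blast
  \<comment> \<open>This inequality lets \<open>\<delta> = \<epsilon>\<close> serve in the other
    direction.\<close>
  have "d_max n d x y \<le> d_T star n d x y"
    if "x \<in> prod_carrier n M" "y \<in> prod_carrier n M" for x y
    unfolding d_T_eq_star_sum d_max_le_iff[OF n]
    using le_star_sum[OF star n, of "\<lambda>i. d i (x i) (y i)"] component_metric(1) that by blast
  with \<open>0 < \<epsilon>\<close> show "\<exists>\<delta>>0. \<forall>x\<in>prod_carrier n M. \<forall>y\<in>prod_carrier n M.
      d_T star n d x y < \<delta> \<longrightarrow> d_max n d x y < \<epsilon>"
    by (meson order_le_less_trans)
qed

text \<open>A finite maximum is below \<open>r\<close> exactly when every entry is, so one radius
  serves all coordinates.\<close>

lemma star_ball_d_max:
  "star_ball (prod_carrier n M) (d_max n d) x r = (\<Pi>\<^sub>E i\<in>{1..n}. star_ball (M i) (d i) (x i) r)"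
  by (auto simp: star_ball_def prod_carrier_def d_max_less_iff[OF n] PiE_iff extensional_def)

text \<open>Balls of \<open>d_max\<close> are open boxes, and every open box around a point contains
  such a ball about it.\<close>

lemma star_topology_d_max:
  "star_topology (prod_carrier n M) (d_max n d)
    = product_topology (\<lambda>i. star_topology (M i) (d i)) {1..n}" (is "?L = ?R")
proof (rule topology_eq[THEN iffD2], intro allI iffI)
  fix A assume A: "openin ?L A"
  show "openin ?R A"
    unfolding openin_product_topology_alt
  proof
    fix x assume "x \<in> A"
    then have x: "x \<in> prod_carrier n M"
      using A by (auto simp: openin_star_topology star_open_def)
    obtain \<epsilon> where \<epsilon>: "0 < \<epsilon>" "star_ball (prod_carrier n M) (d_max n d) x \<epsilon> \<subseteq> A"
      using A \<open>x \<in> A\<close> by (auto simp: openin_star_topology star_open_def)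
    let ?U = "\<lambda>i. star_ball (M i) (d i) (x i) \<epsilon>"
    have "d_max n d x x = 0"
      using star_metric_d_max x by (simp add: star_metric_def)
    then have "x \<in> Pi\<^sub>E {1..n} ?U"
      using star_ball_d_max[of x \<epsilon>] x \<epsilon>(1) by (auto simp: star_ball_def)
    moreover have "openin (star_topology (M i) (d i)) (?U i)" if "i \<in> {1..n}" for i
      using x that by (intro openin_star_ball[OF star metric]) (auto simp: prod_carrier_def)
    \<comment> \<open>The finiteness condition is automatic, the index set being finite.\<close>
    ultimately show "\<exists>U. finite {i \<in> {1..n}. U i \<noteq> topspace (star_topology (M i) (d i))} \<and>
        (\<forall>i\<in>{1..n}. openin (star_topology (M i) (d i)) (U i)) \<and>
        x \<in> Pi\<^sub>E {1..n} U \<and> Pi\<^sub>E {1..n} U \<subseteq> A"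
      using \<epsilon>(2) star_ball_d_max[of x \<epsilon>] by (intro exI[of _ ?U]) auto
  qed
next
  fix A assume A: "openin ?R A"
  show "openin ?L A"
    unfolding openin_star_topology star_open_def
  proof (intro conjI ballI)
    show "A \<subseteq> prod_carrier n M"
      using openin_subset[OF A] by (simp add: topspace_star_topology prod_carrier_def)
    fix x assume "x \<in> A"
    with \<open>A \<subseteq> prod_carrier n M\<close> have x: "x \<in> prod_carrier n M" by blast
    have "\<exists>U. finite {i \<in> {1..n}. U i \<noteq> topspace (star_topology (M i) (d i))} \<and>
        (\<forall>i\<in>{1..n}. openin (star_topology (M i) (d i)) (U i)) \<and>
        x \<in> Pi\<^sub>E {1..n} U \<and> Pi\<^sub>E {1..n} U \<subseteq> A"
      using A[unfolded openin_product_topology_alt] \<open>x \<in> A\<close> by (rule bspec)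
    then obtain U where U: "\<And>i. i \<in> {1..n} \<Longrightarrow> star_open (M i) (d i) (U i)"
      "x \<in> Pi\<^sub>E {1..n} U" "Pi\<^sub>E {1..n} U \<subseteq> A"
      unfolding openin_star_topology by blast
    have "\<exists>e>0. star_ball (M i) (d i) (x i) e \<subseteq> U i" if "i \<in> {1..n}" for i
      using U(1)[OF that] PiE_mem[OF U(2) that] by (simp add: star_open_def)
    then obtain e where e: "\<And>i. i \<in> {1..n} \<Longrightarrow> 0 < e i"
      "\<And>i. i \<in> {1..n} \<Longrightarrow> star_ball (M i) (d i) (x i) (e i) \<subseteq> U i"
      by metis
    \<comment> \<open>The smallest of finitely many positive radii is positive and fits every
      factor; \<open>n \<ge> 1\<close> makes the set nonempty.\<close>
    define \<epsilon> where "\<epsilon> = Min (e ` {1..n})"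
    have "0 < \<epsilon>"
      using e(1) n by (auto simp: \<epsilon>_def)
    have "star_ball (M i) (d i) (x i) \<epsilon> \<subseteq> U i" if "i \<in> {1..n}" for i
    proof -
      have "\<epsilon> \<le> e i" using that by (auto simp: \<epsilon>_def)
      then show ?thesis using e(2)[OF that] by (force simp: star_ball_def)
    qed
    then have "star_ball (prod_carrier n M) (d_max n d) x \<epsilon> \<subseteq> Pi\<^sub>E {1..n} U"
      unfolding star_ball_d_max by (rule PiE_mono)
    with U(3) have "star_ball (prod_carrier n M) (d_max n d) x \<epsilon> \<subseteq> A"
      by (rule order_trans[rotated])
    with \<open>0 < \<epsilon>\<close> show "\<exists>\<epsilon>>0. star_ball (prod_carrier n M) (d_max n d) x \<epsilon> \<subseteq> A"
      by blast
  qed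
qed

end

theorem theorem4p3:
  fixes star :: "real \<Rightarrow> real \<Rightarrow> real"
    and n :: nat
    and M :: "nat \<Rightarrow> 'a set"
    and d :: "nat \<Rightarrow> 'a \<Rightarrow> 'a \<Rightarrow> real"
  assumes "t_definer star"
    and "n \<ge> 1"
    and "\<And>i. i \<in> {1..n} \<Longrightarrow> star_metric star (M i) (d i)"
  shows "star_metric star (prod_carrier n M) (d_max n d)
    \<and> star_metric star (prod_carrier n M) (d_T star n d)
    \<and> star_topology (prod_carrier n M) (d_max n d)
        = product_topology (\<lambda>i. star_topology (M i) (d i)) {1..n}
    \<and> star_topology (prod_carrier n M) (d_T star n d)
        = product_topology (\<lambda>i. star_topology (M i) (d i)) {1..n}"
  using star_metric_d_max[OF assms] star_metric_d_T[OF assms] star_topology_d_max[OF assms]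
    star_topology_d_T_eq_d_max[OF assms]
  by simp

end
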